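(* Let $G$ be the cyclic group of order $n=p_1^{a_1}p_2^{a_2}\cdots p_r^{a_r}$, where $p_1,\dots,p_r$ are distinct primes and $a_i\ge 1$. Then $\overline{\Gamma}(G)$ has $2^r$ vertices. The group $\mathrm{Aut}^*(G)=\mathrm{Aut}(\overline{\Gamma}_{\mathrm w}(G))$ is trivial, while $\mathrm{Aut}(\overline{\Gamma}(G))\cong\mathrm{S}_r$. Hence $\mathrm{Aut}(\Gamma(G))=\prod_{I\subseteq\{1,\ldots,r\}}\mathrm{S}_{n_I}$, where $$n_I=\frac{n}{p_1p_2\cdots p_r}\prod_{i\in I}(p_i-1).$$
   Context: The generating graph $\Gamma(G)$ of a finite group $G$ has vertex set $G$, with $x$ and $y$ joined if and only if $\langle x,y\rangle=G$; by convention, if $G$ is cyclic then every generator of $G$ carries a loop. For $x,y\in G$, $x\equiv_\Gamma y$ means that $x$ and $y$ have the same set of neighbours in $\Gamma(G)$. The reduced generating graph $\overline{\Gamma}(G)$ has as vertices the $\equiv_\Gamma$-classes, two classes being joined if their vertices are joined in $\Gamma(G)$ (with a loop at a class whose elements carry loops). Graph automorphisms preserve loops. $\overline{\Gamma}_{\mathrm w}(G)$ is $\overline{\Gamma}(G)$ with each vertex weighted by the cardinality of the corresponding $\equiv_\Gamma$-class, and $\mathrm{Aut}(\overline{\Gamma}_{\mathrm w}(G))$ is the group of weight-preserving automorphisms of $\overline{\Gamma}(G)$. Automorphisms of $G$ permute the $\equiv_\Gamma$-classes, and $\mathrm{Aut}^*(G)$ denotes the group induced by $\mathrm{Aut}(G)$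 on $\overline{\Gamma}(G)$. $\mathrm{S}_k$ is the symmetric group of degree $k$. *)

theory Defs
  imports
    "HOL-Algebra.Bij"
    "HOL-Algebra.Product_Groups"
    "HOL-Algebra.Sym_Groups"
    "HOL-Computational_Algebra.Primes"
begin

section \<open>Graphs with loops\<close>

text \<open>
  Undirected graphs without multiple edges but possibly with loops: the edges are a symmetric
  set of ordered pairs of vertices, and a pair \<open>(x, x)\<close> is a loop at \<open>x\<close>.
\<close>

record 'v lgraph =
  verts :: "'v set"
  edges :: "('v \<times> 'v) set"

record 'v wgraph = "'v lgraph" +
  weight :: "'v \<Rightarrow> nat"

definition neighbours :: "('v, 'm) lgraph_scheme \<Rightarrow> 'v \<Rightarrow> 'v set" where
  "neighbours \<Gamma> x = {y \<in> verts \<Gamma>. (x, y) \<in> edges \<Gamma>}"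

text \<open>
  As for \<^const>\<open>auto\<close>, automorphisms are extensional functions on the vertex set. Taking
  \<open>x = y\<close> in the condition shows that loops are preserved.
\<close>

definition graph_auts :: "('v, 'm) lgraph_scheme \<Rightarrow> ('v \<Rightarrow> 'v) set" where
  "graph_auts \<Gamma> = {f \<in> Bij (verts \<Gamma>).
     \<forall>x \<in> verts \<Gamma>. \<forall>y \<in> verts \<Gamma>. (f x, f y) \<in> edges \<Gamma> \<longleftrightarrow> (x, y) \<in> edges \<Gamma>}"

definition GraphAutGroup :: "('v, 'm) lgraph_scheme \<Rightarrow> ('v \<Rightarrow> 'v) monoid" where
  "GraphAutGroup \<Gamma> = BijGroup (verts \<Gamma>) \<lparr>carrier := graph_auts \<Gamma>\<rparr>"

definition wgraph_auts :: "('v, 'm) wgraph_scheme \<Rightarrow> ('v \<Rightarrow> 'v) set" where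
  "wgraph_auts \<Gamma> = {f \<in> graph_auts \<Gamma>. \<forall>x \<in> verts \<Gamma>. weight \<Gamma> (f x) = weight \<Gamma> x}"

definition WGraphAutGroup :: "('v, 'm) wgraph_scheme \<Rightarrow> ('v \<Rightarrow> 'v) monoid" where
  "WGraphAutGroup \<Gamma> = BijGroup (verts \<Gamma>) \<lparr>carrier := wgraph_auts \<Gamma>\<rparr>"

section \<open>Generating graphs\<close>

text \<open>
  The case \<open>x = y\<close> is not excluded, so \<open>x\<close> carries a loop iff it generates \<open>G\<close>.
\<close>

definition generating_graph :: "('a, 'b) monoid_scheme \<Rightarrow> 'a lgraph" where
  "generating_graph G =
     \<lparr>verts = carrier G,
      edges = {(x, y) \<in> carrier G \<times> carrier G. generate G {x, y} = carrier G}\<rparr>"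

definition gamma_equiv :: "('a, 'b) monoid_scheme \<Rightarrow> ('a \<times> 'a) set" where
  "gamma_equiv G = {(x, y) \<in> carrier G \<times> carrier G.
     neighbours (generating_graph G) x = neighbours (generating_graph G) y}"

text \<open>
  Whether two classes are joined does not depend on the choice of representatives
  (\<open>reduced_edge_iff\<close> below), so an existential quantifier is used.
\<close>

definition reduced_generating_graph :: "('a, 'b) monoid_scheme \<Rightarrow> 'a set lgraph" where
  "reduced_generating_graph G =
     \<lparr>verts = carrier G // gamma_equiv G,
      edges = {(C, D) \<in> (carrier G // gamma_equiv G) \<times> (carrier G // gamma_equiv G).
                 \<exists>x \<in> C. \<exists>y \<in> D. (x, y) \<in> edges (generating_graph G)}\<rparr>"

definition weighted_reduced_generating_graph :: "('a, 'b) monoid_scheme \<Rightarrow> 'a set wgraph" where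
  "weighted_reduced_generating_graph G =
     \<lparr>verts = verts (reduced_generating_graph G),
      edges = edges (reduced_generating_graph G),
      weight = card\<rparr>"

definition InducedAutGroup :: "('a, 'b) monoid_scheme \<Rightarrow> ('a set \<Rightarrow> 'a set) monoid" where
  "InducedAutGroup G =
     BijGroup (verts (reduced_generating_graph G))
       \<lparr>carrier := (\<lambda>\<phi>. \<lambda>C \<in> verts (reduced_generating_graph G). \<phi> ` C) ` auto G\<rparr>"

lemma generating_graph_edge_sym:
  "(x, y) \<in> edges (generating_graph G) \<longleftrightarrow> (y, x) \<in> edges (generating_graph G)"
proof -
  have "generate G {x, y} = generate G {y, x}"
    by (rule arg_cong[of "{x, y}"]) blast
  then show ?thesis
    unfolding generating_graph_def by simp blast
qed

lemma gamma_equiv_edge_cong: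
  assumes "(x, x') \<in> gamma_equiv G" "y \<in> carrier G"
  shows "(x, y) \<in> edges (generating_graph G) \<longleftrightarrow> (x', y) \<in> edges (generating_graph G)"
proof -
  have eq: "neighbours (generating_graph G) x = neighbours (generating_graph G) x'"
    using assms(1) unfolding gamma_equiv_def by blast
  have "y \<in> verts (generating_graph G)"
    using assms(2) by (simp add: generating_graph_def)
  then have "(z, y) \<in> edges (generating_graph G) \<longleftrightarrow> y \<in> neighbours (generating_graph G) z" for z
    unfolding neighbours_def by blast
  then show ?thesis
    using eq by blast
qed

lemma reduced_edge_iff:
  assumes "x \<in> carrier G" "y \<in> carrier G"
  shows "(gamma_equiv G `` {x}, gamma_equiv G `` {y}) \<in> edges (reduced_generating_graph G)
           \<longleftrightarrow> (x, y) \<in> edges (generating_graph G)"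
    (is "?L \<longleftrightarrow> ?R")
proof
  assume ?L
  then have "\<exists>x' \<in> gamma_equiv G `` {x}. \<exists>y' \<in> gamma_equiv G `` {y}.
      (x', y') \<in> edges (generating_graph G)"
    unfolding reduced_generating_graph_def lgraph.simps by blast
  then obtain x' y' where *: "(x, x') \<in> gamma_equiv G" "(y, y') \<in> gamma_equiv G"
      "(x', y') \<in> edges (generating_graph G)"
    by blast
  from *(2) have "y' \<in> carrier G"
    unfolding gamma_equiv_def by blast
  then have "(x, y') \<in> edges (generating_graph G)"
    using gamma_equiv_edge_cong[OF *(1)] *(3) by blast
  then have "(y', x) \<in> edges (generating_graph G)"
    by (rule generating_graph_edge_sym[THEN iffD1])
  then have "(y, x) \<in> edges (generating_graph G)"
    using gamma_equiv_edge_cong[OF *(2) assms(1)] by blast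
  then show ?R
    by (rule generating_graph_edge_sym[THEN iffD1])
next
  assume ?R
  moreover have "x \<in> gamma_equiv G `` {x}" "y \<in> gamma_equiv G `` {y}"
    using assms unfolding gamma_equiv_def by blast+
  moreover have "gamma_equiv G `` {x} \<in> carrier G // gamma_equiv G"
      "gamma_equiv G `` {y} \<in> carrier G // gamma_equiv G"
    using assms by (blast intro: quotientI)+
  ultimately show ?L
    unfolding reduced_generating_graph_def lgraph.simps by blast
qed

end

theory Submission
  imports Defs "HOL-Algebra.Multiplicative_Group" "HOL-Number_Theory.Cong"
begin

text \<open>
  Let \<open>supp x\<close> be the set of \<open>i\<close> such that \<open>x\<close> lies outside the subgroup of index \<open>p\<^sub>i\<close>. These are the
  maximal subgroups, so \<open>x\<close> and \<open>y\<close> generate \<open>G\<close> iff \<open>supp x \<union> supp y = {1..r}\<close>. Hence the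
  \<open>\<equiv>\<^sub>\<Gamma>\<close>-classes are the fibres of \<open>supp\<close>, and the reduced graph is the graph on all subsets of
  \<open>{1..r}\<close> in which \<open>I\<close>, \<open>J\<close> are joined iff they cover \<open>{1..r}\<close>. Inclusion of neighbourhoods is
  inclusion of subsets in this graph, so its automorphisms are induced by permutations of
  \<open>{1..r}\<close>. The fibre sizes of the singletons are proportional to the distinct numbers \<open>p\<^sub>i - 1\<close>, so
  an automorphism preserving the weights is trivial. In particular, every automorphism of
  \<open>\<Gamma>(G)\<close> preserves each fibre, on which it may act by an arbitrary permutation.
\<close>

section \<open>Automorphism groups of graphs\<close>

lemma GraphAutGroup_simps:
  "carrier (GraphAutGroup \<Gamma>) = graph_auts \<Gamma>"
  "monoid.mult (GraphAutGroup \<Gamma>) = monoid.mult (BijGroup (verts \<Gamma>))"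
  by (simp_all add: GraphAutGroup_def)

lemma BijGroup_mult:
  "\<lbrakk>g \<in> Bij S; f \<in> Bij S\<rbrakk> \<Longrightarrow> g \<otimes>\<^bsub>BijGroup S\<^esub> f = (\<lambda>x\<in>S. g (f x))"
  by (simp add: BijGroup_def compose_def)

lemma graph_autsD:
  assumes "f \<in> graph_auts \<Gamma>"
  shows "f \<in> Bij (verts \<Gamma>)"
    and "\<lbrakk>x \<in> verts \<Gamma>; y \<in> verts \<Gamma>\<rbrakk> \<Longrightarrow> (f x, f y) \<in> edges \<Gamma> \<longleftrightarrow> (x, y) \<in> edges \<Gamma>"
  using assms by (auto simp: graph_auts_def)

lemma Bij_mem: "\<lbrakk>f \<in> Bij S; x \<in> S\<rbrakk> \<Longrightarrow> f x \<in> S"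
  using Bij_imp_funcset by blast

section \<open>Conjugation along graph isomorphisms\<close>

lemma Bij_conjugate:
  assumes h: "bij_betw h S T" and f: "f \<in> Bij S"
  shows "(\<lambda>y\<in>T. h (f (inv_into S h y))) \<in> Bij T"
proof -
  have "bij_betw f S S"
    using f by (simp add: Bij_def)
  with h have "bij_betw (h \<circ> f \<circ> inv_into S h) T T"
    by (blast intro: bij_betw_trans bij_betw_inv_into)
  also have "?this \<longleftrightarrow> bij_betw (\<lambda>y\<in>T. h (f (inv_into S h y))) T T"
    by (rule bij_betw_cong) simp
  finally have "bij_betw (\<lambda>y\<in>T. h (f (inv_into S h y))) T T" .
  then show ?thesis
    by (simp add: Bij_def)
qed

lemma graph_auts_conjugate:
  assumes h: "bij_betw h (verts A) (verts B)"
    and edge: "\<And>x y. \<lbrakk>x \<in> verts A; y \<in> verts A\<rbrakk> \<Longrightarrow> (h x, h y) \<in> edges B \<longleftrightarrow> (x, y) \<in> edges A"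
    and f: "f \<in> graph_auts A"
  shows "(\<lambda>y\<in>verts B. h (f (inv_into (verts A) h y))) \<in> graph_auts B"
proof -
  let ?k = "inv_into (verts A) h"
  have k: "?k y \<in> verts A" "h (?k y) = y" if "y \<in> verts B" for y
    using h that by (auto simp: bij_betw_def inv_into_into f_inv_into_f)
  have "(h (f (?k x)), h (f (?k y))) \<in> edges B \<longleftrightarrow> (x, y) \<in> edges B"
    if "x \<in> verts B" "y \<in> verts B" for x y
  proof -
    have "(h (f (?k x)), h (f (?k y))) \<in> edges B \<longleftrightarrow> (f (?k x), f (?k y)) \<in> edges A"
      using that k f by (intro edge) (auto dest: graph_autsD Bij_mem)
    also have "\<dots> \<longleftrightarrow> (?k x, ?k y) \<in> edges A"
      using that k f by (auto dest: graph_autsD)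
    also have "\<dots> \<longleftrightarrow> (x, y) \<in> edges B"
      using edge[of "?k x" "?k y"] that k by simp
    finally show ?thesis .
  qed
  then show ?thesis
    using Bij_conjugate[OF h graph_autsD(1)[OF f]] by (simp add: graph_auts_def)
qed

text \<open>Conjugation by \<open>h\<close> is the isomorphism, and conjugation by the inverse of
  \<open>h\<close> undoes it. Both are restricted to the vertex sets because automorphisms are
  extensional.\<close>

lemma GraphAutGroup_iso:
  assumes h: "bij_betw h (verts A) (verts B)"
    and edge: "\<And>x y. \<lbrakk>x \<in> verts A; y \<in> verts A\<rbrakk> \<Longrightarrow> (h x, h y) \<in> edges B \<longleftrightarrow> (x, y) \<in> edges A"
  shows "GraphAutGroup A \<cong> GraphAutGroup B"
proof -
  let ?k = "inv_into (verts A) h"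
  let ?\<phi> = "\<lambda>f. \<lambda>y\<in>verts B. h (f (?k y))"
  let ?\<psi> = "\<lambda>g. \<lambda>x\<in>verts A. ?k (g (h x))"
  have k: "?k y \<in> verts A" "h (?k y) = y" if "y \<in> verts B" for y
    using h that by (auto simp: bij_betw_def inv_into_into f_inv_into_f)
  have kh: "h x \<in> verts B" "?k (h x) = x" if "x \<in> verts A" for x
    using h that by (auto simp: bij_betw_def)
  have kbij: "bij_betw ?k (verts B) (verts A)"
    using h by (rule bij_betw_inv_into)
  have kedge: "(?k x, ?k y) \<in> edges A \<longleftrightarrow> (x, y) \<in> edges B" if "x \<in> verts B" "y \<in> verts B" for x y
    using edge[of "?k x" "?k y"] that k by simp
  \<comment> \<open>To apply \<open>graph_auts_conjugate\<close> to \<open>?k\<close>, the inverse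
    of \<open>?k\<close> has to be recognised as \<open>h\<close>.\<close>
  have inv: "inv_into (verts B) ?k x = h x" if "x \<in> verts A" for x
    using h that by (simp add: inv_into_inv_into_eq)
  have \<psi>: "?\<psi> g \<in> graph_auts A" if "g \<in> graph_auts B" for g
  proof -
    have "(\<lambda>x\<in>verts A. ?k (g (inv_into (verts B) ?k x))) \<in> graph_auts A"
      by (rule graph_auts_conjugate[OF kbij _ that]) (rule kedge)
    also have "(\<lambda>x\<in>verts A. ?k (g (inv_into (verts B) ?k x))) = ?\<psi> g"
      by (rule restrict_ext) (simp add: inv)
    finally show ?thesis .
  qed
  have \<phi>: "?\<phi> f \<in> graph_auts B" if "f \<in> graph_auts A" for f
    using graph_auts_conjugate[OF h edge that] .
  have "bij_betw ?\<phi> (graph_auts A) (graph_auts B)"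
  proof (rule bij_betw_byWitness[where f' = ?\<psi>])
    show "\<forall>f\<in>graph_auts A. ?\<psi> (?\<phi> f) = f"
    proof
      fix f assume f: "f \<in> graph_auts A"
      show "?\<psi> (?\<phi> f) = f"
        using graph_autsD(1)[OF f] kh
        by (intro extensionalityI[of _ "verts A"]) (auto simp: Bij_imp_extensional Bij_mem)
    qed
    show "\<forall>g\<in>graph_auts B. ?\<phi> (?\<psi> g) = g"
    proof
      fix g assume g: "g \<in> graph_auts B"
      show "?\<phi> (?\<psi> g) = g"
        using graph_autsD(1)[OF g] k
        by (intro extensionalityI[of _ "verts B"]) (auto simp: Bij_imp_extensional Bij_mem)
    qed
  qed (use \<phi> \<psi> in auto)
  moreover have "?\<phi> \<in> hom (GraphAutGroup A) (GraphAutGroup B)"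
  proof (rule homI)
    fix f g assume "f \<in> carrier (GraphAutGroup A)" "g \<in> carrier (GraphAutGroup A)"
    then have f: "f \<in> graph_auts A" and g: "g \<in> graph_auts A"
      by (simp_all add: GraphAutGroup_simps)
    note fB = graph_autsD(1)[OF f] and gB = graph_autsD(1)[OF g]
    show "?\<phi> (f \<otimes>\<^bsub>GraphAutGroup A\<^esub> g) = ?\<phi> f \<otimes>\<^bsub>GraphAutGroup B\<^esub> ?\<phi> g"
      unfolding GraphAutGroup_simps BijGroup_mult[OF fB gB]
        BijGroup_mult[OF graph_autsD(1)[OF \<phi>[OF f]] graph_autsD(1)[OF \<phi>[OF g]]]
      by (rule restrict_ext) (simp add: k kh Bij_mem[OF gB])
  qed (simp add: GraphAutGroup_simps \<phi>)
  ultimately show ?thesis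
    by (auto simp: is_iso_def iso_def GraphAutGroup_simps)
qed

text \<open>With no edges every bijection is an automorphism, so \<open>GraphAutGroup_iso\<close>
  also transports symmetric groups between sets of equal size.\<close>

lemma GraphAutGroup_edgeless: "GraphAutGroup \<lparr>verts = S, edges = {}\<rparr> = BijGroup S"
  by (simp add: GraphAutGroup_def graph_auts_def BijGroup_def)

lemma BijGroup_iso_sym_group:
  assumes "finite S"
  shows "BijGroup S \<cong> sym_group (card S)"
proof -
  let ?T = "{1..card S}"
  obtain h where "bij_betw h S ?T"
    using assms by (metis ex_bij_betw_finite_nat bij_betw_same_card card_atLeastAtMost diff_Suc_1
        finite_atLeastAtMost finite_same_card_bij)
  then have "BijGroup S \<cong> BijGroup ?T"
    using GraphAutGroup_iso[of h "\<lparr>verts = S, edges = {}\<rparr>" "\<lparr>verts = ?T, edges = {}\<rparr>"]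
    by (simp add: GraphAutGroup_edgeless)
  moreover have "BijGroup ?T \<cong> sym_group (card S)"
  proof -
    \<comment> \<open>The two groups differ only in the convention outside \<open>?T\<close>:
      members of \<open>Bij ?T\<close> are \<open>undefined\<close> there, permutations of
      \<open>?T\<close> fix every point.\<close>
    let ?\<phi> = "\<lambda>f x. if x \<in> ?T then f x else x"
    have \<phi>: "?\<phi> f permutes ?T" if "f \<in> Bij ?T" for f
    proof (rule bij_imp_permutes)
      have "bij_betw f ?T ?T"
        using that by (simp add: Bij_def)
      then show "bij_betw (?\<phi> f) ?T ?T"
        by (rule iffD1[OF bij_betw_cong, rotated]) simp
    qed auto
    have "bij_betw ?\<phi> (Bij ?T) {p. p permutes ?T}"
    proof (rule bij_betw_byWitness[where f' = "\<lambda>p. restrict p ?T"])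
      show "\<forall>f\<in>Bij ?T. restrict (?\<phi> f) ?T = f"
        by (auto simp: Bij_def fun_eq_iff extensional_def)
      show "\<forall>p\<in>{p. p permutes ?T}. ?\<phi> (restrict p ?T) = p"
        by (auto simp: fun_eq_iff permutes_def)
      show "(\<lambda>p. restrict p ?T) ` {p. p permutes ?T} \<subseteq> Bij ?T"
        by (auto simp: Bij_def permutes_imp_bij)
    qed (use \<phi> in auto)
    moreover have "?\<phi> \<in> hom (BijGroup ?T) (sym_group (card S))"
    proof (rule homI)
      fix f g assume "f \<in> carrier (BijGroup ?T)" "g \<in> carrier (BijGroup ?T)"
      then have f: "f \<in> Bij ?T" and g: "g \<in> Bij ?T"
        by (simp_all add: BijGroup_def)
      show "?\<phi> (f \<otimes>\<^bsub>BijGroup ?T\<^esub> g) = ?\<phi> f \<otimes>\<^bsub>sym_group (card S)\<^esub> ?\<phi> g"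
        using Bij_mem[OF g] unfolding BijGroup_mult[OF f g] sym_group_def
        by (auto simp: fun_eq_iff)
    qed (use \<phi> in \<open>auto simp: BijGroup_def sym_group_def\<close>)
    ultimately show ?thesis
      by (auto simp: is_iso_def iso_def BijGroup_def sym_group_def)
  qed
  ultimately show ?thesis
    by (rule iso_trans)
qed

section \<open>Graphs of covering pairs of subsets\<close>

text \<open>The model for the reduced generating graph, a class being replaced by its support. As
  the case \<open>I = J\<close> is included, the only loop is at \<open>R\<close>, the support of
  the generators.\<close>

definition cover_graph :: "'b set \<Rightarrow> 'b set lgraph" where
  "cover_graph R = \<lparr>verts = Pow R, edges = {(I, J) \<in> Pow R \<times> Pow R. I \<union> J = R}\<rparr>"

text \<open>Inclusion can be read off from adjacency: \<open>I \<subseteq> J\<close> iff every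
  neighbour of \<open>I\<close> is a neighbour of \<open>J\<close>. Hence \<open>t\<close> is an
  automorphism of the lattice of subsets; it permutes the singletons and is determined by what it
  does to them.\<close>

lemma cover_graph_aut_image:
  assumes t: "t \<in> graph_auts (cover_graph R)"
  obtains \<sigma> where "\<sigma> \<in> Bij R" "\<And>I. I \<subseteq> R \<Longrightarrow> t I = \<sigma> ` I"
proof -
  have tb: "bij_betw t (Pow R) (Pow R)"
    using graph_autsD(1)[OF t] by (simp add: cover_graph_def Bij_def)
  then have tin: "t I \<subseteq> R" if "I \<subseteq> R" for I
    using that by (auto dest: bij_betwE)
  have tsurj: "\<exists>I\<subseteq>R. t I = J" if "J \<subseteq> R" for J
    using tb that unfolding bij_betw_def by (metis PowD PowI imageE)
  have edge: "t I \<union> t J = R \<longleftrightarrow> I \<union> J = R" if "I \<subseteq> R" "J \<subseteq> R" for I J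
    using graph_autsD(2)[OF t, of I J] that tin[of I] tin[of J] by (simp add: cover_graph_def)
  have sub: "I \<subseteq> J \<longleftrightarrow> (\<forall>K\<subseteq>R. I \<union> K = R \<longrightarrow> J \<union> K = R)" if "I \<subseteq> R" "J \<subseteq> R" for I J
  proof
    assume *: "\<forall>K\<subseteq>R. I \<union> K = R \<longrightarrow> J \<union> K = R"
    \<comment> \<open>The complement of \<open>I\<close> is its smallest neighbour, hence the
      decisive one to test.\<close>
    then have "J \<union> (R - I) = R"
      using \<open>I \<subseteq> R\<close> by blast
    then show "I \<subseteq> J"
      using \<open>I \<subseteq> R\<close> by blast
  qed (use that in blast)
  have mono: "t I \<subseteq> t J \<longleftrightarrow> I \<subseteq> J" if IJ: "I \<subseteq> R" "J \<subseteq> R" for I J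
  proof -
    have "t I \<subseteq> t J \<longleftrightarrow> (\<forall>K\<subseteq>R. t I \<union> t K = R \<longrightarrow> t J \<union> t K = R)"
      using sub[OF tin[OF IJ(1)] tin[OF IJ(2)]] tsurj tin by metis
    also have "\<dots> \<longleftrightarrow> I \<subseteq> J"
      using sub[OF IJ] edge IJ by metis
    finally show ?thesis .
  qed
  have inj: "I = J" if "I \<subseteq> R" "J \<subseteq> R" "t I = t J" for I J
    using mono[of I J] mono[of J I] that by blast
  have bot: "t {} = {}"
    using tsurj[of "{}"] mono[of "{}"] by blast
  \<comment> \<open>Atoms go to atoms: the preimage of a singleton inside \<open>t {i}\<close> is
    nonempty and contained in \<open>{i}\<close>, hence equal to it.\<close>
  have "\<exists>j\<in>R. t {i} = {j}" if i: "i \<in> R" for i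
  proof -
    have "t {i} \<noteq> {}"
      using inj[of "{i}" "{}"] bot i by auto
    then obtain j where j: "j \<in> t {i}" by blast
    then have "j \<in> R" using tin[of "{i}"] i by auto
    then obtain K where K: "K \<subseteq> R" "t K = {j}"
      using tsurj[of "{j}"] by auto
    then have "K \<subseteq> {i}"
      using mono[of K "{i}"] i j by auto
    moreover have "K \<noteq> {}"
      using K bot by auto
    ultimately have "K = {i}" by auto
    then show ?thesis using K \<open>j \<in> R\<close> by auto
  qed
  then obtain \<sigma>0 where \<sigma>0: "\<And>i. i \<in> R \<Longrightarrow> \<sigma>0 i \<in> R \<and> t {i} = {\<sigma>0 i}"
    by metis
  define \<sigma> where "\<sigma> = restrict \<sigma>0 R"
  have \<sigma>: "\<sigma> i \<in> R" "t {i} = {\<sigma> i}" if "i \<in> R" for i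
    using \<sigma>0[OF that] that by (auto simp: \<sigma>_def)
  have "inj_on \<sigma> R"
  proof (rule inj_onI)
    fix i j assume "i \<in> R" "j \<in> R" "\<sigma> i = \<sigma> j"
    then show "i = j"
      using \<sigma>[of i] \<sigma>[of j] inj[of "{i}" "{j}"] by auto
  qed
  have surj: "\<exists>i\<in>R. \<sigma> i = j" if j: "j \<in> R" for j
  proof -
    obtain K where K: "K \<subseteq> R" "t K = {j}"
      using tsurj[of "{j}"] j by auto
    then have "K \<noteq> {}"
      using bot by auto
    then obtain i where "i \<in> K"
      by blast
    then show ?thesis
      using K \<sigma>[of i] mono[of "{i}" K] by auto
  qed
  have "\<sigma> \<in> Bij R"
    using \<open>inj_on \<sigma> R\<close> surj \<sigma>(1) unfolding Bij_def bij_betw_def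
    by (auto simp: \<sigma>_def)
  moreover have "t I = \<sigma> ` I" if I: "I \<subseteq> R" for I
  proof -
    \<comment> \<open>Membership is inclusion of a singleton, so \<open>mono\<close> applies to
      it.\<close>
    have "\<sigma> i \<in> t I \<longleftrightarrow> i \<in> I" if "i \<in> R" for i
      using mono[of "{i}" I] \<sigma>[of i] I that by auto
    then show ?thesis
      using surj tin[OF I] I by (auto simp: image_iff) (metis subsetD)+
  qed
  ultimately show ?thesis
    using that by blast
qed

text \<open>The isomorphism is the action of permutations on subsets. It is faithful because
  singletons are among the subsets, and onto by \<open>cover_graph_aut_image\<close>.\<close>

lemma GraphAutGroup_cover_graph: "BijGroup R \<cong> GraphAutGroup (cover_graph R)"
proof -
  let ?\<phi> = "\<lambda>\<sigma>. \<lambda>I\<in>Pow R. \<sigma> ` I"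
  have \<phi>: "?\<phi> \<sigma> \<in> graph_auts (cover_graph R)" if "\<sigma> \<in> Bij R" for \<sigma>
  proof -
    have \<sigma>: "inj_on \<sigma> R" "\<sigma> ` R = R"
      using that by (auto simp: Bij_def bij_betw_def)
    have "bij_betw (\<lambda>I. \<sigma> ` I) (Pow R) (Pow R)"
      using that by (intro bij_betw_Pow) (simp add: Bij_def)
    then have "bij_betw (?\<phi> \<sigma>) (Pow R) (Pow R)"
      by (rule iffD1[OF bij_betw_cong, rotated]) simp
    then have "?\<phi> \<sigma> \<in> Bij (Pow R)"
      by (simp add: Bij_def)
    moreover have "\<sigma> ` I \<union> \<sigma> ` J = R \<longleftrightarrow> I \<union> J = R" if "I \<subseteq> R" "J \<subseteq> R" for I J
      using inj_on_image_eq_iff[OF \<sigma>(1), of "I \<union> J" R] that \<sigma>(2) by (auto simp: image_Un)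
    moreover have "\<sigma> ` I \<subseteq> R" if "I \<subseteq> R" for I
      using that \<sigma>(2) by blast
    ultimately show ?thesis
      by (simp add: graph_auts_def cover_graph_def)
  qed
  have "inj_on ?\<phi> (Bij R)"
  proof (rule inj_onI)
    fix \<sigma> \<tau> assume \<sigma>: "\<sigma> \<in> Bij R" and \<tau>: "\<tau> \<in> Bij R" and eq: "?\<phi> \<sigma> = ?\<phi> \<tau>"
    show "\<sigma> = \<tau>"
    proof (rule extensionalityI[of _ R])
      fix i assume "i \<in> R"
      then show "\<sigma> i = \<tau> i"
        using fun_cong[OF eq, of "{i}"] by simp
    qed (use \<sigma> \<tau> in \<open>auto simp: Bij_imp_extensional\<close>)
  qed
  moreover have "?\<phi> ` Bij R = graph_auts (cover_graph R)"
  proof (intro equalityI subsetI)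
    fix t assume t: "t \<in> graph_auts (cover_graph R)"
    obtain \<sigma> where \<sigma>: "\<sigma> \<in> Bij R" "\<And>I. I \<subseteq> R \<Longrightarrow> t I = \<sigma> ` I"
      using cover_graph_aut_image[OF t] by metis
    have "t \<in> extensional (Pow R)"
      using graph_autsD(1)[OF t] by (simp add: cover_graph_def Bij_def)
    then have "t = ?\<phi> \<sigma>"
      using \<sigma>(2) by (intro extensionalityI[of _ "Pow R"]) auto
    then show "t \<in> ?\<phi> ` Bij R"
      using \<sigma>(1) by blast
  qed (use \<phi> in auto)
  moreover have "?\<phi> \<in> hom (BijGroup R) (GraphAutGroup (cover_graph R))"
  proof (rule homI)
    fix f g assume "f \<in> carrier (BijGroup R)" "g \<in> carrier (BijGroup R)"
    then have f: "f \<in> Bij R" and g: "g \<in> Bij R"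
      by (simp_all add: BijGroup_def)
    have "?\<phi> (\<lambda>x\<in>R. f (g x)) = (\<lambda>I\<in>Pow R. ?\<phi> f (?\<phi> g I))"
    proof (rule restrict_ext)
      fix I assume "I \<in> Pow R"
      then show "(\<lambda>x\<in>R. f (g x)) ` I = ?\<phi> f (?\<phi> g I)"
        using Bij_mem[OF g] by (force simp: image_image)
    qed
    moreover have "verts (cover_graph R) = Pow R"
      by (simp add: cover_graph_def)
    ultimately show "?\<phi> (f \<otimes>\<^bsub>BijGroup R\<^esub> g) = ?\<phi> f \<otimes>\<^bsub>GraphAutGroup (cover_graph R)\<^esub> ?\<phi> g"
      using BijGroup_mult[OF graph_autsD(1)[OF \<phi>[OF f]] graph_autsD(1)[OF \<phi>[OF g]]]
      by (simp add: GraphAutGroup_simps BijGroup_mult[OF f g])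
  qed (use \<phi> in \<open>auto simp: BijGroup_def GraphAutGroup_simps\<close>)
  ultimately show ?thesis
    by (auto simp: is_iso_def iso_def bij_betw_def GraphAutGroup_simps BijGroup_def)
qed

text \<open>The permutation inducing \<open>t\<close> moves \<open>i\<close> to a point whose
  singleton has the same weight, which is \<open>i\<close> itself. Later \<open>w\<close> is the
  size of the fibre over a subset.\<close>

lemma cover_graph_aut_trivial:
  assumes t: "t \<in> graph_auts (cover_graph R)"
    and w: "inj_on (\<lambda>i. w {i}) R" "\<And>i. i \<in> R \<Longrightarrow> w (t {i}) = w {i}"
    and I: "I \<subseteq> R"
  shows "t I = I"
proof -
  obtain \<sigma> where \<sigma>: "\<sigma> \<in> Bij R" "\<And>I. I \<subseteq> R \<Longrightarrow> t I = \<sigma> ` I"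
    using cover_graph_aut_image[OF t] by metis
  have "\<sigma> i = i" if "i \<in> R" for i
    using w(2)[OF that] \<sigma>(2)[of "{i}"] that Bij_mem[OF \<sigma>(1) that] inj_onD[OF w(1), of "\<sigma> i" i]
    by simp
  then have "\<sigma> ` I = I"
    using I by (simp add: subset_iff)
  then show ?thesis
    using \<sigma>(2)[OF I] by simp
qed

section \<open>Graphs in which vertices are joined when their supports cover\<close>

locale support_map =
  fixes V :: "'a set" and R :: "'b set" and s :: "'a \<Rightarrow> 'b set"
  assumes s_image: "s ` V = Pow R"
    and finite_V: "finite V"
    and weights: "inj_on (\<lambda>i. card {x \<in> V. s x = {i}}) R"
begin

definition fibre :: "'b set \<Rightarrow> 'a set" where
  "fibre I = {x \<in> V. s x = I}"

lemma s_subset: "x \<in> V \<Longrightarrow> s x \<subseteq> R"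
  using s_image by blast

lemma ex_s: "I \<subseteq> R \<Longrightarrow> \<exists>x\<in>V. s x = I"
  using s_image by (metis PowI imageE)

lemma fibre_neq_empty: "I \<subseteq> R \<Longrightarrow> fibre I \<noteq> {}"
  using ex_s by (auto simp: fibre_def)

text \<open>Inclusion of supports is again expressed by adjacency, so \<open>f\<close> induces an
  automorphism \<open>t\<close> of the covering graph. Since \<open>f\<close> maps the fibre over
  \<open>{i}\<close> bijectively onto the fibre over \<open>t {i}\<close>, the assumption
  \<open>weights\<close> forces \<open>t\<close> to be the identity.\<close>

lemma cover_aut_preserves:
  assumes f: "f \<in> Bij V"
    and edge: "\<And>x y. \<lbrakk>x \<in> V; y \<in> V\<rbrakk> \<Longrightarrow> s (f x) \<union> s (f y) = R \<longleftrightarrow> s x \<union> s y = R"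
    and x: "x \<in> V"
  shows "s (f x) = s x"
proof -
  have fV: "f x \<in> V" if "x \<in> V" for x
    using f that by (rule Bij_mem)
  have fsurj: "\<exists>y\<in>V. f y = x" if "x \<in> V" for x
  proof -
    have "x \<in> f ` V"
      using f that by (simp add: Bij_def bij_betw_def)
    then show ?thesis
      by blast
  qed
  have sub: "s (f x) \<subseteq> s (f y)" if "x \<in> V" "y \<in> V" "s x \<subseteq> s y" for x y
  proof -
    \<comment> \<open>The complement is taken on the image side and pulled back along
      \<open>f\<close>; for the converse \<open>sub'\<close> it is taken on the source side.\<close>
    obtain z where z: "z \<in> V" "s (f z) = R - s (f x)"
      using ex_s[of "R - s (f x)"] fsurj by blast
    then have "s x \<union> s z = R"
      using edge[of x z] that(1) s_subset[OF fV[OF that(1)]] by blast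
    then have "s (f y) \<union> s (f z) = R"
      using edge[of y z] that z(1) s_subset[of y] s_subset[of z] by blast
    then show ?thesis
      using z(2) s_subset[OF fV[OF that(1)]] by blast
  qed
  have sub': "s x \<subseteq> s y" if "x \<in> V" "y \<in> V" "s (f x) \<subseteq> s (f y)" for x y
  proof -
    obtain z where z: "z \<in> V" "s z = R - s x"
      using ex_s[of "R - s x"] by blast
    then have "s (f x) \<union> s (f z) = R"
      using edge[of x z] that(1) s_subset[OF that(1)] by blast
    then have "s (f y) \<union> s (f z) = R"
      using that z(1) s_subset[OF fV[of y]] s_subset[OF fV[of z]] by blast
    then have "s y \<union> s z = R"
      using edge[of y z] that z(1) by blast
    then show ?thesis
      using z(2) s_subset[OF that(1)] by blast
  qed
  \<comment> \<open>\<open>inv_into\<close> picks an arbitrary vertex with support \<open>I\<close>.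
    By \<open>sub\<close>, used in both directions, the choice does not affect the support of its
    image.\<close>
  define t where "t = (\<lambda>I\<in>Pow R. s (f (inv_into V s I)))"
  have t: "t (s x) = s (f x)" if "x \<in> V" for x
  proof -
    have "inv_into V s (s x) \<in> V" "s (inv_into V s (s x)) = s x"
      using that by (auto simp: inv_into_into f_inv_into_f)
    then have "s (f (inv_into V s (s x))) = s (f x)"
      using sub[of "inv_into V s (s x)" x] sub[of x "inv_into V s (s x)"] that by blast
    then show ?thesis
      using s_subset[OF that] by (simp add: t_def)
  qed
  have "t \<in> graph_auts (cover_graph R)"
  proof -
    have tPow: "t I \<subseteq> R" if I: "I \<subseteq> R" for I
    proof -
      obtain x where "x \<in> V" "s x = I"
        using ex_s[OF I] by blast
      then show ?thesis
        using t[of x] s_subset[OF fV, of x] by simp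
    qed
    have "inj_on t (Pow R)"
    proof (rule inj_onI)
      fix I J assume "I \<in> Pow R" "J \<in> Pow R" and eq: "t I = t J"
      then obtain x y where "x \<in> V" "s x = I" "y \<in> V" "s y = J"
        using ex_s[of I] ex_s[of J] by blast
      then show "I = J"
        using t[of x] t[of y] eq sub'[of x y] sub'[of y x] by auto
    qed
    moreover have "t ` Pow R = Pow R"
    proof (intro equalityI subsetI)
      fix J assume "J \<in> Pow R"
      then obtain z where z: "z \<in> V" "s z = J"
        using ex_s[of J] by blast
      then obtain y where "y \<in> V" "s (f y) = J"
        using fsurj[OF z(1)] by blast
      then show "J \<in> t ` Pow R"
        using t[of y] s_subset[of y] by blast
    qed (use tPow in auto)
    moreover have "t I \<union> t J = R \<longleftrightarrow> I \<union> J = R" if IJ: "I \<subseteq> R" "J \<subseteq> R" for I J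
    proof -
      obtain x y where "x \<in> V" "s x = I" "y \<in> V" "s y = J"
        using ex_s[OF IJ(1)] ex_s[OF IJ(2)] by blast
      then show ?thesis
        using t[of x] t[of y] edge[of x y] by simp
    qed
    ultimately show ?thesis
      using tPow by (simp add: graph_auts_def cover_graph_def Bij_def bij_betw_def t_def)
  qed
  moreover have "card (fibre (t {i})) = card (fibre {i})" if i: "i \<in> R" for i
  proof -
    \<comment> \<open>Comparing sizes takes equality, not just inclusion: a vertex over
      \<open>t {i}\<close> has a preimage under \<open>f\<close>, and \<open>sub'\<close> shows that
      this preimage has support \<open>{i}\<close>.\<close>
    have "f ` fibre {i} = fibre (t {i})"
    proof (intro equalityI subsetI)
      fix y assume "y \<in> fibre (t {i})"
      then have y: "y \<in> V" "s y = t {i}"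
        by (auto simp: fibre_def)
      obtain z where z: "z \<in> V" "f z = y"
        using fsurj y(1) by blast
      obtain x where x: "x \<in> V" "s x = {i}"
        using ex_s[of "{i}"] i by auto
      have "s (f z) = s (f x)"
        using t[of x] x y z by simp
      then have "s z = {i}"
        using sub'[of z x] sub'[of x z] x z by auto
      then show "y \<in> f ` fibre {i}"
        using z by (auto simp: fibre_def)
    next
      fix y assume "y \<in> f ` fibre {i}"
      then obtain x where "x \<in> V" "s x = {i}" "y = f x"
        unfolding fibre_def by blast
      then show "y \<in> fibre (t {i})"
        using t[of x] fV by (simp add: fibre_def)
    qed
    moreover have "inj_on f (fibre {i})"
      using f by (auto simp: Bij_def bij_betw_def fibre_def intro: inj_on_subset)
    ultimately show ?thesis
      using card_image[of f "fibre {i}"] by simp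
  qed
  moreover have "inj_on (\<lambda>i. card (fibre {i})) R"
    using weights by (simp add: fibre_def)
  ultimately have "t (s x) = s x"
    using s_subset[OF x] by (intro cover_graph_aut_trivial[where w = "\<lambda>I. card (fibre I)"])
  then show ?thesis
    using t[OF x] by simp
qed

text \<open>Automorphisms preserve supports and so restrict to every fibre. Conversely, permutations
  of the fibres glue to a bijection that preserves supports, and adjacency depends on the supports
  alone.\<close>

lemma GraphAutGroup_iso_product:
  assumes verts: "verts \<Gamma> = V"
    and edges: "\<And>x y. \<lbrakk>x \<in> V; y \<in> V\<rbrakk> \<Longrightarrow> (x, y) \<in> edges \<Gamma> \<longleftrightarrow> s x \<union> s y = R"
  shows "GraphAutGroup \<Gamma> \<cong> product_group (Pow R) (\<lambda>I. BijGroup (fibre I))"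
proof -
  let ?P = "product_group (Pow R) (\<lambda>I. BijGroup (fibre I))"
  let ?\<phi> = "\<lambda>f. \<lambda>I\<in>Pow R. restrict f (fibre I)"
  let ?\<psi> = "\<lambda>g. \<lambda>x\<in>V. g (s x) x"
  have carrier_P: "carrier ?P = (\<Pi>\<^sub>E I\<in>Pow R. Bij (fibre I))"
    by (simp add: BijGroup_def)
  have preserve: "s (f x) = s x" if f: "f \<in> graph_auts \<Gamma>" and x: "x \<in> V" for f x
  proof (rule cover_aut_preserves[OF _ _ x])
    show fB: "f \<in> Bij V"
      using graph_autsD(1)[OF f] by (simp add: verts)
    show "s (f x) \<union> s (f y) = R \<longleftrightarrow> s x \<union> s y = R" if "x \<in> V" "y \<in> V" for x y
      using graph_autsD(2)[OF f, of x y] that edges Bij_mem[OF fB] by (simp add: verts)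
  qed
  have fibre_Bij: "restrict f (fibre I) \<in> Bij (fibre I)" if f: "f \<in> graph_auts \<Gamma>" for f I
  proof -
    have fb: "bij_betw f V V"
      using graph_autsD(1)[OF f] by (simp add: verts Bij_def)
    have "f ` fibre I = fibre I"
    proof (intro equalityI subsetI)
      fix y assume y: "y \<in> fibre I"
      then have "y \<in> f ` V"
        using fb by (simp add: fibre_def bij_betw_def)
      then obtain x where "x \<in> V" "f x = y"
        by blast
      then show "y \<in> f ` fibre I"
        using preserve[OF f, of x] y by (auto simp: fibre_def)
    qed (use preserve[OF f] fb in \<open>auto simp: fibre_def bij_betw_def\<close>)
    moreover have "inj_on f (fibre I)"
      using fb by (auto simp: bij_betw_def fibre_def intro: inj_on_subset)
    ultimately show ?thesis
      by (simp add: Bij_def bij_betw_def)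
  qed
  have \<phi>: "?\<phi> f \<in> carrier ?P" if "f \<in> graph_auts \<Gamma>" for f
    unfolding carrier_P using fibre_Bij[OF that] by simp
  have \<psi>: "?\<psi> g \<in> graph_auts \<Gamma>" if g: "g \<in> carrier ?P" for g
  proof -
    have gB: "g I \<in> Bij (fibre I)" if "I \<subseteq> R" for I
      using g that unfolding carrier_P by auto
    have gx: "g (s x) x \<in> V \<and> s (g (s x) x) = s x" if x: "x \<in> V" for x
      using Bij_mem[OF gB[OF s_subset[OF x]], of x] x by (auto simp: fibre_def)
    have "inj_on (?\<psi> g) V"
    proof (rule inj_onI)
      fix x y assume x: "x \<in> V" and y: "y \<in> V" and "?\<psi> g x = ?\<psi> g y"
      then have eq: "g (s x) x = g (s y) y" by simp
      then have "s x = s y"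
        using gx[OF x] gx[OF y] by metis
      then have "x \<in> fibre (s x)" "y \<in> fibre (s x)" "g (s x) x = g (s x) y"
        using x y eq by (auto simp: fibre_def)
      then show "x = y"
        using gB[OF s_subset[OF x]] by (auto simp: Bij_def bij_betw_def dest: inj_onD)
    qed
    \<comment> \<open>An injective map of the finite set \<open>V\<close> into itself is
      onto.\<close>
    moreover have "?\<psi> g ` V = V"
      using gx calculation finite_V by (intro endo_inj_surj) auto
    ultimately have "?\<psi> g \<in> Bij V"
      by (simp add: Bij_def bij_betw_def)
    then show ?thesis
      using gx by (simp add: graph_auts_def verts edges)
  qed
  have "bij_betw ?\<phi> (graph_auts \<Gamma>) (carrier ?P)"
  proof (rule bij_betw_byWitness[where f' = ?\<psi>])
    show "\<forall>f\<in>graph_auts \<Gamma>. ?\<psi> (?\<phi> f) = f"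
    proof
      fix f assume f: "f \<in> graph_auts \<Gamma>"
      show "?\<psi> (?\<phi> f) = f"
        using graph_autsD(1)[OF f] s_subset
        by (intro extensionalityI[of _ V]) (auto simp: verts Bij_imp_extensional fibre_def)
    qed
    show "\<forall>g\<in>carrier ?P. ?\<phi> (?\<psi> g) = g"
    proof
      fix g assume g: "g \<in> carrier ?P"
      then have gB: "g I \<in> Bij (fibre I)" if "I \<subseteq> R" for I
        using that unfolding carrier_P by auto
      show "?\<phi> (?\<psi> g) = g"
      proof (rule extensionalityI[of _ "Pow R"])
        fix I assume I: "I \<in> Pow R"
        have "restrict (?\<psi> g) (fibre I) = g I"
          using gB[of I] I
          by (intro extensionalityI[of _ "fibre I"]) (auto simp: Bij_imp_extensional fibre_def)
        then show "?\<phi> (?\<psi> g) I = g I"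
          using I by simp
      qed (use g in \<open>auto simp: PiE_def\<close>)
    qed
    show "?\<phi> ` graph_auts \<Gamma> \<subseteq> carrier ?P"
      using \<phi> by (rule image_subsetI)
    show "?\<psi> ` carrier ?P \<subseteq> graph_auts \<Gamma>"
      using \<psi> by (rule image_subsetI)
  qed
  moreover have "?\<phi> \<in> hom (GraphAutGroup \<Gamma>) ?P"
  proof (rule homI)
    fix f g assume "f \<in> carrier (GraphAutGroup \<Gamma>)" "g \<in> carrier (GraphAutGroup \<Gamma>)"
    then have f: "f \<in> graph_auts \<Gamma>" and g: "g \<in> graph_auts \<Gamma>"
      by (simp_all add: GraphAutGroup_simps)
    have "restrict (\<lambda>x\<in>V. f (g x)) (fibre I) =
        restrict f (fibre I) \<otimes>\<^bsub>BijGroup (fibre I)\<^esub> restrict g (fibre I)" for I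
      unfolding BijGroup_mult[OF fibre_Bij[OF f] fibre_Bij[OF g]]
      using Bij_mem[OF fibre_Bij[OF g], of _ I]
      by (intro ext) (auto simp: fibre_def)
    then show "?\<phi> (f \<otimes>\<^bsub>GraphAutGroup \<Gamma>\<^esub> g) = ?\<phi> f \<otimes>\<^bsub>?P\<^esub> ?\<phi> g"
      unfolding GraphAutGroup_simps BijGroup_mult[OF graph_autsD(1)[OF f] graph_autsD(1)[OF g]]
      by (simp add: verts cong: restrict_cong)
  qed (simp only: GraphAutGroup_simps \<phi>)
  ultimately show ?thesis
    unfolding is_iso_def iso_def GraphAutGroup_simps by blast
qed

end

section \<open>Finite cyclic groups\<close>

text \<open>Chinese remainder theorem: \<open>k\<close> corresponds to its quotient by the product,
  with \<open>m\<close> values, and its residues modulo the \<open>p i\<close>, which are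
  independent. The pattern asks for a nonzero residue if \<open>i \<in> I\<close>, leaving
  \<open>p i - 1\<close> choices, and for residue 0 otherwise.\<close>

lemma card_divisibility_pattern:
  fixes p :: "'i \<Rightarrow> nat"
  assumes R: "finite R" "I \<subseteq> R"
    and pos: "\<And>i. i \<in> R \<Longrightarrow> p i > 0"
    and cop: "\<And>i j. \<lbrakk>i \<in> R; j \<in> R; i \<noteq> j\<rbrakk> \<Longrightarrow> coprime (p i) (p j)"
  shows "card {k. k < m * (\<Prod>i\<in>R. p i) \<and> (\<forall>i\<in>R. p i dvd k \<longleftrightarrow> i \<notin> I)} = m * (\<Prod>i\<in>I. p i - 1)"
    (is "card ?K = _")
proof -
  let ?P = "\<Prod>i\<in>R. p i"
  define \<phi> where "\<phi> k = (k div ?P, \<lambda>i\<in>R. k mod p i)" for k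
  define D where "D i = (if i \<in> I then {0<..<p i} else {0})" for i
  have P: "?P > 0"
    using pos by (rule prod_pos)
  have inj: "inj_on \<phi> {..<m * ?P}"
  proof (rule inj_onI)
    fix k l assume "\<phi> k = \<phi> l"
    then have div: "k div ?P = l div ?P" and mods: "(\<lambda>i\<in>R. k mod p i) = (\<lambda>i\<in>R. l mod p i)"
      by (simp_all add: \<phi>_def)
    have "[k = l] (mod p i)" if "i \<in> R" for i
      using fun_cong[OF mods, of i] that by (simp add: cong_def)
    then have "[k = l] (mod ?P)"
      using cop by (intro cong_cong_prod_coprime_nat) blast+
    then have "k mod ?P = l mod ?P"
      by (simp add: cong_def)
    have "k = k div ?P * ?P + k mod ?P"
      by (rule div_mult_mod_eq[symmetric])
    also have "\<dots> = l div ?P * ?P + l mod ?P"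
      unfolding div \<open>k mod ?P = l mod ?P\<close> ..
    also have "\<dots> = l"
      by (rule div_mult_mod_eq)
    finally show "k = l" .
  qed
  \<comment> \<open>By counting: \<open>\<phi>\<close> is injective and both sides have
    \<open>m * ?P\<close> elements, so no simultaneous solution of congruences has to be
    constructed.\<close>
  have surj: "\<phi> ` {..<m * ?P} = {..<m} \<times> (\<Pi>\<^sub>E i\<in>R. {..<p i})"
  proof (rule card_subset_eq)
    show "\<phi> ` {..<m * ?P} \<subseteq> {..<m} \<times> (\<Pi>\<^sub>E i\<in>R. {..<p i})"
      using pos by (auto simp: \<phi>_def less_mult_imp_div_less)
    show "card (\<phi> ` {..<m * ?P}) = card ({..<m} \<times> (\<Pi>\<^sub>E i\<in>R. {..<p i}))"
      using R(1) by (simp add: card_image[OF inj] card_cartesian_product card_PiE)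
  qed (use R(1) in \<open>simp add: finite_PiE\<close>)
  have D: "k mod p i \<in> D i \<longleftrightarrow> (p i dvd k \<longleftrightarrow> i \<notin> I)" if "i \<in> R" for k i
    using pos[OF that] by (simp add: D_def dvd_eq_mod_eq_0)
  have \<phi>_iff: "\<phi> k \<in> {..<m} \<times> Pi\<^sub>E R D \<longleftrightarrow> (\<forall>i\<in>R. p i dvd k \<longleftrightarrow> i \<notin> I)" if "k < m * ?P" for k
    using D that by (simp add: \<phi>_def less_mult_imp_div_less PiE_iff)
  have sub: "{..<m} \<times> Pi\<^sub>E R D \<subseteq> \<phi> ` {..<m * ?P}"
    unfolding surj using pos by (intro Sigma_mono order.refl PiE_mono) (simp add: D_def subset_eq)
  have "\<phi> ` ?K = {..<m} \<times> Pi\<^sub>E R D"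
  proof (intro equalityI subsetI)
    fix y assume "y \<in> {..<m} \<times> Pi\<^sub>E R D"
    moreover from this obtain k where "k < m * ?P" "y = \<phi> k"
      using sub by blast
    ultimately show "y \<in> \<phi> ` ?K"
      using \<phi>_iff[of k] by simp
  next
    fix y assume "y \<in> \<phi> ` ?K"
    then obtain k where "k \<in> ?K" "y = \<phi> k"
      by (rule imageE)
    then show "y \<in> {..<m} \<times> Pi\<^sub>E R D"
      using \<phi>_iff[of k] by simp
  qed
  moreover have "inj_on \<phi> ?K"
    using inj by (rule inj_on_subset) auto
  ultimately have "card ?K = card ({..<m} \<times> Pi\<^sub>E R D)"
    using card_image[of \<phi> ?K] by simp
  also have "\<dots> = m * (\<Prod>i\<in>R. card (D i))"
    using R(1) by (simp add: card_cartesian_product card_PiE)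
  also have "(\<Prod>i\<in>R. card (D i)) = (\<Prod>i\<in>R. if i \<in> I then p i - 1 else 1)"
    by (rule prod.cong) (simp_all add: D_def)
  also have "\<dots> = (\<Prod>i\<in>I. p i - 1)"
    using R by (simp add: prod.inter_restrict[symmetric] Int_absorb1)
  finally show ?thesis .
qed

locale finite_cyclic_group = group G for G :: "('a, 'b) monoid_scheme" (structure) +
  fixes n r :: nat and p a :: "nat \<Rightarrow> nat"
  assumes cyclic: "cyclic_group G" and order: "order G = n"
    and n: "n = (\<Prod>i = 1..r. p i ^ a i)"
    and prime: "\<And>i. i \<in> {1..r} \<Longrightarrow> prime (p i)"
    and inj_p: "inj_on p {1..r}"
    and a: "\<And>i. i \<in> {1..r} \<Longrightarrow> a i \<ge> 1"
begin

text \<open>The elements killed by the exponent \<open>n div p i\<close> form the kernel of a power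
  map, which in a cyclic group of order \<open>n\<close> is the subgroup of index
  \<open>p i\<close>. This description involves no choice of generator and is visibly invariant
  under automorphisms.\<close>

definition supp :: "'a \<Rightarrow> nat set" where
  "supp x = {i \<in> {1..r}. x [^] (n div p i) \<noteq> \<one>}"

text \<open>The number \<open>n_I\<close>. The division is exact by \<open>radical_dvd_n\<close>,
  and the subtraction does not truncate because every \<open>p i\<close> is a prime.\<close>

abbreviation class_size :: "nat set \<Rightarrow> nat" where
  "class_size I \<equiv> n div (\<Prod>i = 1..r. p i) * (\<Prod>i\<in>I. p i - 1)"

section \<open>The order, the powers of a generator and the fibre sizes\<close>

lemma n_pos: "n > 0"
  unfolding n by (rule prod_pos) (use prime prime_gt_0_nat in simp)

lemma p_dvd_n:
  assumes "i \<in> {1..r}"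
  shows "p i dvd n"
proof (rule dvd_trans)
  show "p i dvd p i ^ a i"
    using a[OF assms] by (simp add: dvd_power)
  show "p i ^ a i dvd n"
    unfolding n using assms by (intro dvd_prodI) auto
qed

lemma radical_dvd_n: "(\<Prod>i = 1..r. p i) dvd n"
  unfolding n
proof (rule prod_dvd_prod)
  fix i assume "i \<in> {1..r}"
  then show "p i dvd p i ^ a i"
    using a[of i] by (simp add: dvd_power)
qed

lemma finite_carrier: "finite (carrier G)"
  using order n_pos by (simp add: order_def card_ge_0_finite)

text \<open>Cyclicity supplies integer exponents. As the generator has order \<open>n\<close>, its
  powers with natural exponents below \<open>n\<close> are distinct, and by counting they exhaust
  the group.\<close>

lemma ex_generator: "\<exists>g\<in>carrier G. bij_betw (\<lambda>k::nat. g [^] k) {..<n} (carrier G)"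
proof -
  obtain g where g: "g \<in> carrier G" "carrier G = range (\<lambda>k::int. g [^] k)"
    using cyclic cyclic_group by blast
  then have "generate G {g} = carrier G"
    using generate_pow[OF g(1)] by auto
  then have ord: "ord g = n"
    using generate_pow_card[OF g(1)] order by (simp add: order_def)
  then have "{0..ord g - 1} = {..<n}"
    using n_pos by auto
  then have inj: "inj_on (\<lambda>k::nat. g [^] k) {..<n}"
    using ord_inj[OF g(1)] by simp
  moreover have "(\<lambda>k::nat. g [^] k) ` {..<n} = carrier G"
    using g(1) finite_carrier card_image[OF inj] order
    by (intro card_subset_eq) (auto simp: order_def)
  ultimately show ?thesis
    using g(1) by (auto simp: bij_betw_def)
qed

lemma pow_eq_one_iff:
  assumes g: "g \<in> carrier G" "bij_betw (\<lambda>k::nat. g [^] k) {..<n} (carrier G)"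
  shows "g [^] (k::nat) = \<one> \<longleftrightarrow> n dvd k"
proof
  assume "g [^] k = \<one>"
  have "g [^] k = g [^] (n * (k div n)) \<otimes> g [^] (k mod n)"
    using g(1) by (simp add: nat_pow_mult)
  also have "g [^] (n * (k div n)) = \<one>"
    using g(1) order pow_order_eq_1 by (simp flip: nat_pow_pow)
  finally have "g [^] (k mod n) = g [^] (0::nat)"
    using g(1) \<open>g [^] k = \<one>\<close> by simp
  then have "k mod n = 0"
    using inj_onD[OF bij_betw_imp_inj_on[OF g(2)], of "k mod n" 0] n_pos by simp
  then show "n dvd k"
    by auto
next
  assume "n dvd k"
  then show "g [^] k = \<one>"
    using g(1) order pow_order_eq_1 by (auto simp flip: nat_pow_pow elim!: dvdE)
qed

text \<open>The power is trivial iff \<open>n\<close> divides \<open>k * (n div p i)\<close>;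
  cancelling the nonzero factor \<open>n div p i\<close> leaves \<open>p i dvd k\<close>.\<close>

lemma supp_pow:
  assumes g: "g \<in> carrier G" "bij_betw (\<lambda>k::nat. g [^] k) {..<n} (carrier G)"
  shows "supp (g [^] k) = {i \<in> {1..r}. \<not> p i dvd k}"
proof -
  have "(g [^] k) [^] (n div p i) = \<one> \<longleftrightarrow> p i dvd k" if i: "i \<in> {1..r}" for i
  proof -
    have "(g [^] k) [^] (n div p i) = \<one> \<longleftrightarrow> n dvd k * (n div p i)"
      using pow_eq_one_iff[OF g] g(1) by (simp add: nat_pow_pow)
    also have "\<dots> \<longleftrightarrow> p i * (n div p i) dvd k * (n div p i)"
      using p_dvd_n[OF i] by simp
    also have "\<dots> \<longleftrightarrow> p i dvd k"
      using p_dvd_n[OF i] n_pos by (intro dvd_times_right_cancel_iff) (auto elim!: dvdE)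
    finally show ?thesis .
  qed
  then show ?thesis
    by (auto simp: supp_def)
qed

text \<open>In terms of exponents of a generator, a support is a divisibility pattern, so this is
  the Chinese remainder count with \<open>m\<close> the quotient of \<open>n\<close> by its
  radical.\<close>

lemma card_supp:
  assumes "I \<subseteq> {1..r}"
  shows "card {x \<in> carrier G. supp x = I} = class_size I"
proof -
  obtain g where g: "g \<in> carrier G" "bij_betw (\<lambda>k::nat. g [^] k) {..<n} (carrier G)"
    using ex_generator by blast
  let ?K = "{k. k < n \<and> (\<forall>i\<in>{1..r}. p i dvd k \<longleftrightarrow> i \<notin> I)}"
  have supp_iff: "supp (g [^] k) = I \<longleftrightarrow> (\<forall>i\<in>{1..r}. p i dvd k \<longleftrightarrow> i \<notin> I)" for k
    unfolding supp_pow[OF g] using assms by blast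
  have "bij_betw (\<lambda>k::nat. g [^] k) ?K {x \<in> carrier G. supp x = I}"
  proof (rule bij_betw_subset[OF g(2)])
    show "(\<lambda>k. g [^] k) ` ?K = {x \<in> carrier G. supp x = I}"
    proof (intro equalityI subsetI)
      fix x assume x: "x \<in> {x \<in> carrier G. supp x = I}"
      then have "x \<in> (\<lambda>k::nat. g [^] k) ` {..<n}"
        using g(2) by (simp add: bij_betw_def)
      then obtain k :: nat where "k < n" "x = g [^] k"
        by blast
      then show "x \<in> (\<lambda>k. g [^] k) ` ?K"
        using x supp_iff by blast
    qed (use supp_iff g(1) in auto)
  qed auto
  then have "card {x \<in> carrier G. supp x = I} = card ?K"
    by (rule bij_betw_same_card[symmetric])
  also have "?K = {k. k < n div (\<Prod>i = 1..r. p i) * (\<Prod>i = 1..r. p i) \<and>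
      (\<forall>i\<in>{1..r}. p i dvd k \<longleftrightarrow> i \<notin> I)}"
    using radical_dvd_n by simp
  also have "card \<dots> = class_size I"
  proof (rule card_divisibility_pattern)
    fix i assume "i \<in> {1..r}"
    then show "p i > 0"
      using prime prime_gt_0_nat by blast
  next
    fix i j assume ij: "i \<in> {1..r}" "j \<in> {1..r}" "i \<noteq> j"
    then have "p i \<noteq> p j"
      using inj_onD[OF inj_p] by blast
    then show "coprime (p i) (p j)"
      using prime ij by (intro primes_coprime)
  qed (use assms in auto)
  finally show ?thesis .
qed

text \<open>Positivity makes every subset occur as a support, and lets the common factor be
  cancelled when the fibres over two singletons are compared.\<close>

lemma class_size_pos:
  assumes "I \<subseteq> {1..r}"
  shows "class_size I > 0"
proof -
  have "n div (\<Prod>i = 1..r. p i) > 0"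
    using radical_dvd_n n_pos by (auto elim!: dvdE)
  moreover have "p i - 1 > 0" if "i \<in> I" for i
    using prime[of i] assms that prime_gt_1_nat[of "p i"] by auto
  ultimately show ?thesis
    by (simp add: prod_pos)
qed

sublocale support_map "carrier G" "{1..r}" supp
proof
  show "supp ` carrier G = Pow {1..r}"
  proof (intro equalityI subsetI)
    fix I assume "I \<in> Pow {1..r}"
    then have "card {x \<in> carrier G. supp x = I} > 0"
      using card_supp class_size_pos by simp
    then show "I \<in> supp ` carrier G"
      by (metis (mono_tags, lifting) card_gt_0_iff empty_Collect_eq image_eqI)
  qed (auto simp: supp_def)
  show "inj_on (\<lambda>i. card {x \<in> carrier G. supp x = {i}}) {1..r}"
  proof (rule inj_onI)
    fix i j assume ij: "i \<in> {1..r}" "j \<in> {1..r}"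
      and "card {x \<in> carrier G. supp x = {i}} = card {x \<in> carrier G. supp x = {j}}"
    then have "class_size {i} = class_size {j}"
      using card_supp[of "{i}"] card_supp[of "{j}"] by simp
    moreover have "class_size {i} > 0"
      using class_size_pos[of "{i}"] ij by simp
    \<comment> \<open>The common factor is nonzero because \<open>class_size {i}\<close> is.\<close>
    ultimately have "p i - 1 = p j - 1"
      by simp
    then have "p i = p j"
      using prime[OF ij(1)] prime[OF ij(2)] prime_gt_0_nat
      by (metis Suc_diff_1)
    then show "i = j"
      using inj_p ij by (auto dest: inj_onD)
  qed
qed (rule finite_carrier)

section \<open>Generating pairs in terms of supports\<close>

lemma supp_subgroup:
  assumes "i \<in> {1..r}"
  shows "subgroup {x \<in> carrier G. i \<notin> supp x} G"
proof -
  interpret comm_group G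
    using cyclic_imp_abelian_group[OF cyclic] .
  show ?thesis
    using assms by (intro subgroupI) (auto simp: supp_def pow_mult_distrib m_comm nat_pow_inv)
qed

text \<open>If \<open>i\<close> is missing from both supports, then \<open>x\<close> and
  \<open>y\<close> lie in the subgroup of index \<open>p i\<close>, which is proper because some
  element has full support. If they generate a proper subgroup, some prime \<open>p i\<close>
  divides its index, and then \<open>i\<close> is missing from both supports.\<close>

lemma generate_iff_supp:
  assumes x: "x \<in> carrier G" and y: "y \<in> carrier G"
  shows "generate G {x, y} = carrier G \<longleftrightarrow> supp x \<union> supp y = {1..r}"
proof
  assume gen: "generate G {x, y} = carrier G"
  have "i \<in> supp x \<union> supp y" if i: "i \<in> {1..r}" for i
  proof (rule ccontr)
    assume "i \<notin> supp x \<union> supp y"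
    then have "generate G {x, y} \<subseteq> {z \<in> carrier G. i \<notin> supp z}"
      using x y by (intro generate_subgroup_incl[OF _ supp_subgroup[OF i]]) auto
    moreover obtain z where "z \<in> carrier G" "supp z = {1..r}"
      using ex_s[of "{1..r}"] by blast
    ultimately show False
      using gen i by blast
  qed
  then show "supp x \<union> supp y = {1..r}"
    using s_subset[OF x] s_subset[OF y] by blast
next
  assume cover: "supp x \<union> supp y = {1..r}"
  let ?H = "generate G {x, y}"
  have H: "subgroup ?H G"
    using x y by (intro generate_is_subgroup) auto
  interpret H: group "G\<lparr>carrier := ?H\<rparr>"
    using subgroup.subgroup_is_group[OF H] is_group by blast
  obtain c where c: "c * card ?H = n"
    using lagrange[OF H] order by auto
  show "?H = carrier G"
  proof (cases "c = 1")
    case True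
    then show ?thesis
      using c order finite_carrier subgroup.subset[OF H]
      by (intro card_subset_eq) (auto simp: order_def)
  next
    case False
    then obtain q where q: "prime q" "q dvd c"
      using prime_factor_nat by blast
    then have "q dvd n"
      using c by auto
    then obtain i where i: "i \<in> {1..r}" "q dvd p i ^ a i"
      using q(1) unfolding n by (auto simp: prime_dvd_prod_iff)
    then have "q = p i"
      using q(1) prime[OF i(1)] prime_dvd_power primes_dvd_imp_eq by blast
    with q obtain d where "c = p i * d"
      by auto
    \<comment> \<open>As \<open>p i\<close> divides the index of \<open>?H\<close>, the order of
      \<open>?H\<close> divides \<open>n div p i\<close>, so this exponent kills all of
      \<open>?H\<close>.\<close>
    then have "n div p i = card ?H * d"
      using c prime_gt_0_nat[OF prime[OF i(1)]] by auto
    moreover have "z [^] card ?H = \<one>" if "z \<in> ?H" for z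
      using H.pow_order_eq_1[of z] that by (simp add: order_def flip: nat_pow_consistent)
    ultimately have "z [^] (n div p i) = \<one>" if "z \<in> ?H" for z
      using that subgroup.mem_carrier[OF H that] by (simp flip: nat_pow_pow)
    then have "i \<notin> supp x \<union> supp y"
      by (simp add: supp_def generate.incl)
    then show ?thesis
      using cover i(1) by simp
  qed
qed

section \<open>The classes as fibres of the support\<close>

lemma generating_graph_simps:
  shows "verts (generating_graph G) = carrier G"
    and "\<lbrakk>x \<in> carrier G; y \<in> carrier G\<rbrakk> \<Longrightarrow>
      (x, y) \<in> edges (generating_graph G) \<longleftrightarrow> supp x \<union> supp y = {1..r}"
  by (simp_all add: generating_graph_def generate_iff_supp)

text \<open>An element whose support is the complement of \<open>supp x\<close> is a neighbour of
  \<open>x\<close>; if it is also a neighbour of \<open>y\<close>, then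
  \<open>supp x \<subseteq> supp y\<close>. Equal neighbourhoods give this both ways.\<close>

lemma gamma_equiv_eq:
  "gamma_equiv G = {(x, y) \<in> carrier G \<times> carrier G. supp x = supp y}"
proof -
  have nb: "neighbours (generating_graph G) x = {z \<in> carrier G. supp x \<union> supp z = {1..r}}"
    if "x \<in> carrier G" for x
    using that by (simp add: neighbours_def generating_graph_simps cong: conj_cong)
  have sub: "supp x \<subseteq> supp y"
    if "x \<in> carrier G" "y \<in> carrier G"
      "neighbours (generating_graph G) x = neighbours (generating_graph G) y" for x y
  proof -
    obtain z where z: "z \<in> carrier G" "supp z = {1..r} - supp x"
      using ex_s[of "{1..r} - supp x"] by blast
    then have "z \<in> neighbours (generating_graph G) x"
      using nb[OF that(1)] s_subset[OF that(1)] by blast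
    then have "supp y \<union> supp z = {1..r}"
      using nb[OF that(2)] that(3) by blast
    then show ?thesis
      using z(2) s_subset[OF that(1)] by blast
  qed
  have "neighbours (generating_graph G) x = neighbours (generating_graph G) y \<longleftrightarrow> supp x = supp y"
    if "x \<in> carrier G" "y \<in> carrier G" for x y
  proof
    assume "neighbours (generating_graph G) x = neighbours (generating_graph G) y"
    then show "supp x = supp y"
      using sub[OF that] sub[OF that(2,1)] by simp
  qed (use nb that in simp)
  then show ?thesis
    unfolding gamma_equiv_def by blast
qed

lemma gamma_equiv_class: "x \<in> carrier G \<Longrightarrow> gamma_equiv G `` {x} = fibre (supp x)"
  by (auto simp: gamma_equiv_eq fibre_def)

lemma verts_reduced: "verts (reduced_generating_graph G) = fibre ` Pow {1..r}"
proof -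
  have "carrier G // gamma_equiv G = (\<lambda>x. fibre (supp x)) ` carrier G"
    by (auto simp: quotient_def gamma_equiv_class)
  then show ?thesis
    by (simp only: reduced_generating_graph_def lgraph.simps image_image flip: s_image)
qed

lemma bij_betw_fibre: "bij_betw fibre (Pow {1..r}) (verts (reduced_generating_graph G))"
  unfolding bij_betw_def verts_reduced
proof (intro conjI inj_onI)
  fix I J assume "I \<in> Pow {1..r}" "fibre I = fibre J"
  then show "I = J"
    using fibre_neq_empty[of I] by (auto simp: fibre_def)
qed simp

lemma reduced_edge_fibre_iff:
  assumes "I \<subseteq> {1..r}" "J \<subseteq> {1..r}"
  shows "(fibre I, fibre J) \<in> edges (reduced_generating_graph G) \<longleftrightarrow> I \<union> J = {1..r}"
proof -
  obtain x y where "x \<in> carrier G" "supp x = I" "y \<in> carrier G" "supp y = J"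
    using ex_s assms by meson
  then show ?thesis
    using reduced_edge_iff[of x G y] by (simp add: gamma_equiv_class generating_graph_simps)
qed

text \<open>Recovers from a class the common support of its elements; meaningful on the vertices of
  the reduced graph.\<close>

abbreviation fibre_label :: "'a set \<Rightarrow> nat set" where
  "fibre_label \<equiv> inv_into (Pow {1..r}) fibre"

lemma bij_betw_fibre_label:
  "bij_betw fibre_label (verts (reduced_generating_graph G)) (verts (cover_graph {1..r}))"
  using bij_betw_inv_into[OF bij_betw_fibre] by (simp add: cover_graph_def)

lemma fibre_label_fibre: "I \<subseteq> {1..r} \<Longrightarrow> fibre_label (fibre I) = I"
  using bij_betw_fibre by (simp add: bij_betw_def)

lemma fibre_fibre_label:
  "C \<in> verts (reduced_generating_graph G) \<Longrightarrow> fibre (fibre_label C) = C"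
  unfolding verts_reduced by (rule f_inv_into_f)

lemma fibre_label_edge:
  assumes "C \<in> verts (reduced_generating_graph G)" "D \<in> verts (reduced_generating_graph G)"
  shows "(fibre_label C, fibre_label D) \<in> edges (cover_graph {1..r}) \<longleftrightarrow>
    (C, D) \<in> edges (reduced_generating_graph G)"
proof -
  obtain I J where "I \<subseteq> {1..r}" "C = fibre I" "J \<subseteq> {1..r}" "D = fibre J"
    using assms unfolding verts_reduced by blast
  moreover from this have "fibre_label C = I" "fibre_label D = J"
    by (simp_all only: fibre_label_fibre)
  ultimately show ?thesis
    using reduced_edge_fibre_iff[of I J] by (simp add: cover_graph_def)
qed

section \<open>Determination of the automorphism groups\<close>

lemma GraphAutGroup_reduced_iso: "GraphAutGroup (reduced_generating_graph G) \<cong> sym_group r"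
proof -
  have "GraphAutGroup (reduced_generating_graph G) \<cong> GraphAutGroup (cover_graph {1..r})"
    by (rule GraphAutGroup_iso[OF bij_betw_fibre_label fibre_label_edge])
  also have "\<dots> \<cong> BijGroup {1..r}"
    by (rule group.iso_sym[OF group_BijGroup GraphAutGroup_cover_graph])
  also have "\<dots> \<cong> sym_group (card {1..r})"
    by (rule BijGroup_iso_sym_group) simp
  finally show ?thesis
    by simp
qed

text \<open>The generating graph joins elements with covering supports, so its automorphism group
  splits over the fibres; each factor then depends only on the size of its fibre.\<close>

lemma GraphAutGroup_generating_iso:
  "GraphAutGroup (generating_graph G) \<cong>
     product_group (Pow {1..r}) (\<lambda>I. sym_group (class_size I))"
proof -
  have "GraphAutGroup (generating_graph G) \<cong> product_group (Pow {1..r}) (\<lambda>I. BijGroup (fibre I))"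
    by (rule GraphAutGroup_iso_product) (simp_all add: generating_graph_simps)
  also have "\<dots> \<cong> product_group (Pow {1..r}) (\<lambda>I. sym_group (class_size I))"
  proof (rule iso_product_groupI)
    fix I assume "I \<in> Pow {1..r}"
    then have "card (fibre I) = class_size I"
      using card_supp[of I] by (simp add: fibre_def)
    then show "BijGroup (fibre I) \<cong> sym_group (class_size I)"
      using BijGroup_iso_sym_group[of "fibre I"] finite_carrier by (simp add: fibre_def)
  qed (simp_all add: group_BijGroup sym_group_is_group)
  finally show ?thesis .
qed

text \<open>Labelling classes by supports turns \<open>f\<close> into an automorphism of the
  covering graph that preserves fibre sizes. The fibres over distinct singletons differ in size, so
  it is trivial, and hence so is \<open>f\<close>.\<close>

lemma wgraph_auts_reduced:
  "wgraph_auts (weighted_reduced_generating_graph G) =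
     {\<lambda>C\<in>verts (reduced_generating_graph G). C}"
proof (intro equalityI subsetI)
  let ?V = "verts (reduced_generating_graph G)"
  fix f assume "f \<in> wgraph_auts (weighted_reduced_generating_graph G)"
  then have f: "f \<in> graph_auts (reduced_generating_graph G)"
    and w: "\<And>C. C \<in> ?V \<Longrightarrow> card (f C) = card C"
    by (auto simp: wgraph_auts_def graph_auts_def weighted_reduced_generating_graph_def)
  have fV: "f C \<in> ?V" if "C \<in> ?V" for C
    using graph_autsD(1)[OF f] that by (rule Bij_mem)
  let ?t = "\<lambda>I\<in>verts (cover_graph {1..r}). fibre_label (f (inv_into ?V fibre_label I))"
  \<comment> \<open>On subsets of \<open>{1..r}\<close> the inverse of \<open>fibre_label\<close> is
    \<open>fibre\<close>.\<close>
  have t: "?t I = fibre_label (f (fibre I))" if "I \<subseteq> {1..r}" for I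
    using that inv_into_inv_into_eq[OF bij_betw_fibre] by (simp add: cover_graph_def)
  have "?t \<in> graph_auts (cover_graph {1..r})"
    by (rule graph_auts_conjugate[OF bij_betw_fibre_label fibre_label_edge f])
  moreover have "card (fibre (?t {i})) = card (fibre {i})" if "i \<in> {1..r}" for i
  proof -
    have "fibre {i} \<in> ?V"
      using that by (simp add: verts_reduced)
    moreover from this have "fibre (fibre_label (f (fibre {i}))) = f (fibre {i})"
      by (intro fibre_fibre_label fV)
    ultimately show ?thesis
      using w t[of "{i}"] that by simp
  qed
  moreover have "inj_on (\<lambda>i. card (fibre {i})) {1..r}"
    using weights by (simp add: fibre_def)
  ultimately have tI: "?t I = I" if "I \<subseteq> {1..r}" for I
    using that by (intro cover_graph_aut_trivial[where w = "\<lambda>I. card (fibre I)"])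
  have "f C = C" if C: "C \<in> ?V" for C
  proof -
    obtain I where I: "I \<subseteq> {1..r}" "C = fibre I"
      using C by (auto simp: verts_reduced)
    have "f C = fibre (fibre_label (f C))"
      by (rule fibre_fibre_label[OF fV[OF C], symmetric])
    then show ?thesis
      using t[OF I(1)] tI[OF I(1)] I(2) by simp
  qed
  then have "f = (\<lambda>C\<in>?V. C)"
    using graph_autsD(1)[OF f] by (intro extensionalityI[of _ ?V]) (auto simp: Bij_def)
  then show "f \<in> {\<lambda>C\<in>?V. C}"
    by simp
qed (auto simp: wgraph_auts_def graph_auts_def weighted_reduced_generating_graph_def id_Bij)

text \<open>The identity restricted to the vertices is the unit of \<open>BijGroup\<close>, so the
  carrier is that of the trivial subgroup.\<close>

lemma trivial_WGraphAutGroup: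
  "trivial_group (WGraphAutGroup (weighted_reduced_generating_graph G))"
proof -
  let ?V = "verts (reduced_generating_graph G)"
  have "WGraphAutGroup (weighted_reduced_generating_graph G) =
      BijGroup ?V \<lparr>carrier := {\<one>\<^bsub>BijGroup ?V\<^esub>}\<rparr>"
    unfolding WGraphAutGroup_def wgraph_auts_reduced
    by (simp add: weighted_reduced_generating_graph_def BijGroup_def)
  moreover have "group \<dots>"
    by (intro subgroup.subgroup_is_group group.triv_subgroup group_BijGroup)
  ultimately show ?thesis
    by (simp add: trivial_group_def)
qed

text \<open>Automorphisms neither create nor destroy trivial powers, so they preserve
  supports.\<close>

lemma auto_image_fibre:
  assumes "\<phi> \<in> auto G"
  shows "\<phi> ` fibre I = fibre I"
proof -
  have hom: "\<phi> \<in> hom G G" and bij: "bij_betw \<phi> (carrier G) (carrier G)"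
    using assms by (auto simp: auto_def Bij_def)
  interpret \<phi>: group_hom G G \<phi>
    using hom by unfold_locales
  have "supp (\<phi> x) = supp x" if x: "x \<in> carrier G" for x
  proof -
    have "\<phi> x [^] (k::nat) = \<one> \<longleftrightarrow> x [^] k = \<one>" for k
      using inj_on_eq_iff[OF bij_betw_imp_inj_on[OF bij], of "x [^] k" \<one>] x
      by (simp add: \<phi>.hom_nat_pow)
    then show ?thesis
      by (simp add: supp_def)
  qed
  then have "\<phi> ` fibre I = {y \<in> \<phi> ` carrier G. supp y = I}"
    by (auto simp: fibre_def)
  then show ?thesis
    using bij by (simp add: fibre_def bij_betw_def)
qed

lemma InducedAutGroup_eq:
  "InducedAutGroup G = WGraphAutGroup (weighted_reduced_generating_graph G)"
proof -
  let ?V = "verts (reduced_generating_graph G)"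
  have "(\<lambda>C\<in>?V. \<phi> ` C) = (\<lambda>C\<in>?V. C)" if "\<phi> \<in> auto G" for \<phi>
  proof (rule restrict_ext)
    fix C assume "C \<in> ?V"
    then obtain I where "C = fibre I"
      unfolding verts_reduced by blast
    then show "\<phi> ` C = C"
      using auto_image_fibre[OF that] by simp
  qed
  then have "(\<lambda>\<phi>. \<lambda>C\<in>?V. \<phi> ` C) ` auto G = (\<lambda>\<phi>. \<lambda>C\<in>?V. C) ` auto G"
    by (rule image_cong[OF refl])
  \<comment> \<open>The identity shows that \<open>auto G\<close> is nonempty, so the image of the
    constant map is a singleton and not empty.\<close>
  also have "\<dots> = {\<lambda>C\<in>?V. C}"
    using id_in_auto by auto
  finally show ?thesis
    unfolding InducedAutGroup_def WGraphAutGroup_def wgraph_auts_reduced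
    by (simp add: weighted_reduced_generating_graph_def)
qed

lemma card_verts_reduced: "card (verts (reduced_generating_graph G)) = 2 ^ r"
  using bij_betw_same_card[OF bij_betw_fibre] by (simp add: card_Pow)

end

theorem proposition5p4:
  fixes G :: "('a, 'b) monoid_scheme"
    and n r :: nat
    and p a :: "nat \<Rightarrow> nat"
  assumes "group G" and "cyclic_group G" and "order G = n"
    and "n = (\<Prod>i = 1..r. p i ^ a i)"
    and "\<And>i. i \<in> {1..r} \<Longrightarrow> prime (p i)"
    and "inj_on p {1..r}"
    and "\<And>i. i \<in> {1..r} \<Longrightarrow> a i \<ge> 1"
  shows "card (verts (reduced_generating_graph G)) = 2 ^ r
    \<and> InducedAutGroup G = WGraphAutGroup (weighted_reduced_generating_graph G)
    \<and> trivial_group (WGraphAutGroup (weighted_reduced_generating_graph G))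
    \<and> GraphAutGroup (reduced_generating_graph G) \<cong> sym_group r
    \<and> GraphAutGroup (generating_graph G) \<cong>
        product_group (Pow {1..r})
          (\<lambda>I. sym_group (n div (\<Prod>i = 1..r. p i) * (\<Prod>i \<in> I. (p i - 1))))"
proof -
  interpret finite_cyclic_group G n r p a
    using assms by (intro finite_cyclic_group.intro finite_cyclic_group_axioms.intro)
  show ?thesis
    using card_verts_reduced InducedAutGroup_eq trivial_WGraphAutGroup
      GraphAutGroup_reduced_iso GraphAutGroup_generating_iso by blast
qed

end
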